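(* Let $V=\mathbb R^n$, fix an integer $d$ with $0<d\le n$ and an integer $r$ with $0\le r\le n-d$. Let $W\subseteq\bigwedge^r V$ be a linear subspace. Then there exists a nonempty Zariski open subset of $GL_n(\mathbb R)$ all of whose elements $F$ satisfy $$\frac{\dim\pi^F_{[n-d]}(W)}{\binom{n-d}{r}}\ge\frac{\dim W}{\binom nr}.$$
   Context: $[k]=\{1,\dots,k\}$. For $F\in GL_n(\mathbb R)$ with columns $f_1,\dots,f_n$ (a basis of $V$) and $J\subseteq[n]$, let $V_J=\operatorname{span}\{f_j:j\in J\}$ and let $\pi^F_J:V\to V_J$ be the linear projection $\pi^F_J\left(\sum_{j\in[n]}\alpha_jf_j\right)=\sum_{j\in J}\alpha_jf_j$. The same symbol $\pi^F_J:\bigwedge^r V\to\bigwedge^r V_J$ denotes the induced map on exterior powers: with $f_A=\bigwedge_{a\in A}f_a$ (indices increasing), $\pi^F_J(f_A)=f_A$ if $A\subseteq J$ and $0$ otherwise. Zariski open refers to the $n^2$ matrix entries as coordinates. *)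

theory Defs
  imports "HOL-Analysis.Analysis"
begin

section \<open>The exterior algebra of \<open>\<real>\<^sup>n\<close>\<close>

text \<open>
  The index set \<open>[n]\<close> is a finite linearly ordered type \<open>'n\<close> with \<open>n = CARD('n)\<close>, and
  \<open>V = real ^ 'n\<close>. The exterior algebra of \<open>V\<close> is \<open>real ^ ('n set)\<close>: the coordinate vector
  \<open>axis A 1\<close> stands for \<open>e\<^sub>A\<close>, the wedge, in increasing order, of the standard basis vectors
  \<open>e\<^sub>a\<close> with \<open>a \<in> A\<close> (see \<open>wedge_fam_axis\<close>).
\<close>

type_synonym 'n ext = "(real, 'n set) vec"

definition shuffle_sign :: "'n::linorder set \<Rightarrow> 'n set \<Rightarrow> real" where
  "shuffle_sign A B = (- 1) ^ card {(a, b) \<in> A \<times> B. b < a}"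

definition wedge :: "'n::{finite,linorder} ext \<Rightarrow> 'n ext \<Rightarrow> 'n ext" where
  "wedge x y = (\<Sum>A\<in>UNIV. \<Sum>B\<in>UNIV.
     if A \<inter> B = {} then (x $ A * y $ B * shuffle_sign A B) *\<^sub>R axis (A \<union> B) 1 else 0)"

definition ext_vec :: "real ^ 'n::{finite,linorder} \<Rightarrow> 'n ext" where
  "ext_vec v = (\<Sum>i\<in>UNIV. v $ i *\<^sub>R axis {i} 1)"

definition wedge_list :: "(real ^ 'n::{finite,linorder}) list \<Rightarrow> 'n ext" where
  "wedge_list vs = foldr (\<lambda>v. wedge (ext_vec v)) vs (axis {} 1)"

definition wedge_fam :: "('n \<Rightarrow> real ^ 'n::{finite,linorder}) \<Rightarrow> 'n set \<Rightarrow> 'n ext" where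
  "wedge_fam u A = wedge_list (map u (sorted_list_of_set A))"

definition ext_power :: "nat \<Rightarrow> 'n::{finite,linorder} ext set" where
  "ext_power r = span {axis A 1 |A. card A = r}"

text \<open>
  The map induced on the exterior algebra by a linear map \<open>g\<close>: it sends \<open>e\<^sub>A\<close> to the wedge,
  in increasing order, of the vectors \<open>g e\<^sub>a\<close> with \<open>a \<in> A\<close>.
\<close>

definition ext_map :: "(real ^ 'n::{finite,linorder} \<Rightarrow> real ^ 'n::{finite,linorder}) \<Rightarrow> 'n ext \<Rightarrow> 'n ext" where
  "ext_map g w = (\<Sum>A\<in>UNIV. w $ A *\<^sub>R wedge_fam (\<lambda>a. g (axis a 1)) A)"


section \<open>Projections along a basis\<close>

definition GL :: "(real ^ 'n ^ 'n) set" where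
  "GL = {F. invertible F}"

text \<open>
  For invertible \<open>F\<close>, the coordinates of \<open>v\<close> in the basis of columns of \<open>F\<close> are the entries of
  \<open>matrix_inv F *v v\<close> (see \<open>basis_proj_sum\<close>).
\<close>

definition basis_proj :: "real ^ 'n ^ 'n \<Rightarrow> 'n set \<Rightarrow> real ^ 'n \<Rightarrow> real ^ 'n" where
  "basis_proj F J v = (\<Sum>j\<in>J. (matrix_inv F *v v) $ j *\<^sub>R column j F)"

definition ext_proj :: "real ^ 'n::{finite,linorder} ^ 'n::{finite,linorder} \<Rightarrow> 'n set \<Rightarrow> 'n ext \<Rightarrow> 'n ext" where
  "ext_proj F J = ext_map (basis_proj F J)"

text \<open>The set \<open>[k]\<close>, that is, the \<open>k\<close> smallest indices (for \<open>k \<le> CARD('n)\<close>).\<close>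

definition first :: "nat \<Rightarrow> 'n::{finite,linorder} set" where
  "first k = {i. card {..i} \<le> k}"


section \<open>Zariski topology\<close>

text \<open>
  On a Euclidean space, the library's real polynomial functions are the polynomials in the
  coordinates; on \<open>real ^ 'n ^ 'n\<close> these are the matrix entries.
\<close>

definition zariski_closed :: "'a::euclidean_space set \<Rightarrow> bool" where
  "zariski_closed Z \<longleftrightarrow>
     (\<exists>P. (\<forall>p\<in>P. real_polynomial_function p) \<and> Z = {x. \<forall>p\<in>P. p x = 0})"

definition zariski_open_in :: "'a::euclidean_space set \<Rightarrow> 'a set \<Rightarrow> bool" where
  "zariski_open_in S U \<longleftrightarrow> (\<exists>Z. zariski_closed Z \<and> U = S - Z)"


section \<open>Properties of the exterior algebra\<close>

lemma linear_ext_eqI: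
  fixes f g :: "(real ^ 'i::finite) \<Rightarrow> 'b::real_vector"
  assumes "linear f" "linear g" "\<And>i. f (axis i 1) = g (axis i 1)"
  shows "f x = g x"
proof -
  have x: "x = (\<Sum>i\<in>UNIV. x $ i *\<^sub>R axis i 1)"
    using basis_expansion[of x] by (simp add: scalar_mult_eq_scaleR)
  show ?thesis
    by (subst (1 2) x)
       (simp add: linear_sum[OF assms(1)] linear_sum[OF assms(2)] linear_cmul[OF assms(1)]
         linear_cmul[OF assms(2)] assms(3))
qed

lemma linear_wedge_left: "linear (\<lambda>x. wedge x y)"
  by (rule linearI; unfold wedge_def scaleR_sum_right sum.distrib[symmetric];
      intro sum.cong refl; simp add: algebra_simps)

lemma linear_wedge_right: "linear (\<lambda>y. wedge x y)"
  by (rule linearI; unfold wedge_def scaleR_sum_right sum.distrib[symmetric];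
      intro sum.cong refl; simp add: algebra_simps)

lemma linear_ext_vec: "linear ext_vec"
  by (rule linearI; unfold ext_vec_def scaleR_sum_right sum.distrib[symmetric];
      intro sum.cong refl; simp add: algebra_simps)

lemma linear_ext_map: "linear (ext_map g)"
  by (rule linearI; unfold ext_map_def scaleR_sum_right sum.distrib[symmetric];
      intro sum.cong refl; simp add: algebra_simps)

lemmas wedge_simps =
  linear_add[OF linear_wedge_left] linear_add[OF linear_wedge_right]
  linear_cmul[OF linear_wedge_left] linear_cmul[OF linear_wedge_right]
  linear_0[OF linear_wedge_left] linear_0[OF linear_wedge_right]
  linear_neg[OF linear_wedge_left] linear_neg[OF linear_wedge_right]

lemma wedge_axis:
  "wedge (axis A 1) (axis B 1) =
     (if A \<inter> B = {} then shuffle_sign A B *\<^sub>R axis (A \<union> B) 1 else 0)"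
proof -
  have "wedge (axis A 1) (axis B 1) = (\<Sum>A'\<in>UNIV. \<Sum>B'\<in>UNIV. if A' = A then if B' = B then
      (if A \<inter> B = {} then shuffle_sign A B *\<^sub>R axis (A \<union> B) 1 else 0) else 0 else 0)"
    unfolding wedge_def by (intro sum.cong refl) (auto simp: axis_def)
  also have "\<dots> = (\<Sum>A'\<in>UNIV. if A' = A then \<Sum>B'\<in>UNIV. if B' = B then
      (if A \<inter> B = {} then shuffle_sign A B *\<^sub>R axis (A \<union> B) 1 else 0) else 0 else 0)"
    by (intro sum.cong refl) auto
  finally show ?thesis by simp
qed

lemma ext_vec_axis: "ext_vec (axis i 1) = axis {i} 1"
proof -
  have "ext_vec (axis i 1) = (\<Sum>j\<in>UNIV. if j = i then axis {i} 1 else 0)"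
    unfolding ext_vec_def by (intro sum.cong refl) (auto simp: axis_def)
  then show ?thesis by simp
qed

lemma ext_map_axis: "ext_map g (axis A 1) = wedge_fam (\<lambda>a. g (axis a 1)) A"
proof -
  have "ext_map g (axis A 1) =
      (\<Sum>B\<in>UNIV. if B = A then wedge_fam (\<lambda>a. g (axis a 1)) A else 0)"
    unfolding ext_map_def by (intro sum.cong refl) (auto simp: axis_def)
  then show ?thesis by simp
qed

lemma shuffle_sign_Un_left:
  fixes A :: "'n::{finite,linorder} set"
  assumes "A \<inter> B = {}"
  shows "shuffle_sign (A \<union> B) C = shuffle_sign A C * shuffle_sign B C"
proof -
  have "{(a, b) \<in> (A \<union> B) \<times> C. b < a} =
      {(a, b) \<in> A \<times> C. b < a} \<union> {(a, b) \<in> B \<times> C. b < a}" by auto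
  moreover have "{(a, b) \<in> A \<times> C. b < a} \<inter> {(a, b) \<in> B \<times> C. b < a} = {}"
    using assms by auto
  ultimately show ?thesis
    by (simp add: shuffle_sign_def card_Un_disjoint power_add)
qed

lemma shuffle_sign_Un_right:
  fixes A :: "'n::{finite,linorder} set"
  assumes "B \<inter> C = {}"
  shows "shuffle_sign A (B \<union> C) = shuffle_sign A B * shuffle_sign A C"
proof -
  have "{(a, b) \<in> A \<times> (B \<union> C). b < a} =
      {(a, b) \<in> A \<times> B. b < a} \<union> {(a, b) \<in> A \<times> C. b < a}" by auto
  moreover have "{(a, b) \<in> A \<times> B. b < a} \<inter> {(a, b) \<in> A \<times> C. b < a} = {}"
    using assms by auto
  ultimately show ?thesis
    by (simp add: shuffle_sign_def card_Un_disjoint power_add)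
qed

lemma shuffle_sign_less:
  assumes "\<forall>a\<in>A. \<forall>b\<in>B. a < b"
  shows "shuffle_sign A B = 1"
proof -
  have "{(a, b) \<in> A \<times> B. b < a} = {}"
    using assms less_asym by blast
  then show ?thesis by (simp only: shuffle_sign_def card.empty power_0)
qed

lemma shuffle_sign_single:
  assumes "b < a" shows "shuffle_sign {a} {b} = - 1"
proof -
  have "{(x, y) \<in> {a} \<times> {b}. y < x} = {(a, b)}" using assms by auto
  then show ?thesis by (simp add: shuffle_sign_def)
qed

lemma wedge_assoc:
  fixes x y z :: "'n::{finite,linorder} ext"
  shows "wedge (wedge x y) z = wedge x (wedge y z)"
proof -
  have basis: "wedge (wedge (axis A 1) (axis B 1)) (axis C 1) =
      wedge (axis A 1) (wedge (axis B 1) (axis C 1))" for A B C :: "'n set"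
    by (cases "A \<inter> B = {} \<and> A \<inter> C = {} \<and> B \<inter> C = {}")
       (auto simp: wedge_axis wedge_simps shuffle_sign_Un_left shuffle_sign_Un_right
         Int_Un_distrib Int_Un_distrib2 Un_assoc)
  have 1: "wedge (wedge (axis A 1) (axis B 1)) z = wedge (axis A 1) (wedge (axis B 1) z)"
    for A B :: "'n set" and z :: "'n ext"
    by (rule linear_ext_eqI[OF linear_wedge_right
          linear_compose[OF linear_wedge_right linear_wedge_right, unfolded o_def]])
       (rule basis)
  have 2: "wedge (wedge (axis A 1) y) z = wedge (axis A 1) (wedge y z)"
    for A :: "'n set" and y z :: "'n ext"
    by (rule linear_ext_eqI[OF
          linear_compose[OF linear_wedge_right linear_wedge_left, unfolded o_def]
          linear_compose[OF linear_wedge_left linear_wedge_right, unfolded o_def]])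
       (rule 1)
  show ?thesis
    by (rule linear_ext_eqI[OF
          linear_compose[OF linear_wedge_left linear_wedge_left, unfolded o_def]
          linear_wedge_left])
       (rule 2)
qed

lemma wedge_one_left: "wedge (axis {} 1) x = x"
  by (rule linear_ext_eqI[OF linear_wedge_right linear_ident])
     (simp add: wedge_axis shuffle_sign_def)

lemma wedge_one_right: "wedge x (axis {} 1) = x"
  by (rule linear_ext_eqI[OF linear_wedge_left linear_ident])
     (simp add: wedge_axis shuffle_sign_def)

lemma wedge_vec_anticommute:
  fixes u v :: "real ^ 'n::{finite,linorder}"
  shows "wedge (ext_vec u) (ext_vec v) = - wedge (ext_vec v) (ext_vec u)"
proof -
  have basis: "wedge (ext_vec (axis i 1)) (ext_vec (axis j 1)) =
      - wedge (ext_vec (axis j 1)) (ext_vec (axis i 1))" for i j :: 'n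
  proof (cases i j rule: linorder_cases)
    case less
    then show ?thesis
      by (simp add: ext_vec_axis wedge_axis shuffle_sign_single shuffle_sign_less insert_commute)
  next
    case greater
    then show ?thesis
      by (simp add: ext_vec_axis wedge_axis shuffle_sign_single shuffle_sign_less insert_commute)
  qed (simp add: ext_vec_axis wedge_axis)
  have l: "linear (\<lambda>v. wedge (ext_vec u) (ext_vec v))" "linear (\<lambda>v. - wedge (ext_vec u) (ext_vec v))"
    "linear (\<lambda>v. wedge (ext_vec v) (ext_vec u))" "linear (\<lambda>v. - wedge (ext_vec v) (ext_vec u))"
    for u :: "real ^ 'n::{finite,linorder}"
    by (rule linearI; simp add: linear_add[OF linear_ext_vec] linear_cmul[OF linear_ext_vec] wedge_simps)+
  have 1: "wedge (ext_vec (axis i 1)) (ext_vec v) = - wedge (ext_vec v) (ext_vec (axis i 1))"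
    for i :: 'n and v :: "real ^ 'n::{finite,linorder}"
    by (rule linear_ext_eqI[OF l(1) l(4)]) (rule basis)
  show ?thesis
    by (rule linear_ext_eqI[OF l(3) l(2)]) (rule 1)
qed

lemma wedge_vec_self:
  fixes v :: "real ^ 'n::{finite,linorder}"
  shows "wedge (ext_vec v) (ext_vec v) = 0"
proof -
  have "x = 0" if "x = - x" for x :: "'n ext"
    using that by (simp add: vec_eq_iff)
  then show ?thesis using wedge_vec_anticommute by blast
qed

lemma wedge_fam_empty: "wedge_fam u {} = axis {} 1"
  by (simp add: wedge_fam_def wedge_list_def)

lemma wedge_fam_insert_min:
  assumes "\<And>a. a \<in> A \<Longrightarrow> b < a"
  shows "wedge_fam u (insert b A) = wedge (ext_vec (u b)) (wedge_fam u A)"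
proof -
  have "b \<notin> A" using assms by blast
  moreover have "insort b (sorted_list_of_set A) = b # sorted_list_of_set A"
    by (rule insort_is_Cons) (use assms less_imp_le in auto)
  ultimately have "sorted_list_of_set (insert b A) = b # sorted_list_of_set A"
    by (simp add: sorted_list_of_set_insert)
  then show ?thesis by (simp add: wedge_fam_def wedge_list_def)
qed

lemma wedge_fam_axis: "wedge_fam (\<lambda>a. axis a 1) A = axis A 1"
using finite[of A]
proof (induction A rule: finite_linorder_min_induct)
  case (insert b A)
  then have "shuffle_sign {b} A = 1" by (intro shuffle_sign_less) auto
  moreover have "b \<notin> A" using insert by blast
  ultimately show ?case
    using insert by (simp add: wedge_fam_insert_min ext_vec_axis wedge_axis)
qed (simp_all add: wedge_fam_empty)

lemma wedge_vec_fam: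
  "wedge (ext_vec (u i)) (wedge_fam u A) =
     (if i \<in> A then 0 else shuffle_sign {i} A *\<^sub>R wedge_fam u (insert i A))"
using finite[of A]
proof (induction A rule: finite_linorder_min_induct)
  case empty
  then show ?case
    using wedge_fam_insert_min[of "{}" i u] by (simp add: shuffle_sign_less)
next
  case (insert b A)
  have fam: "wedge_fam u (insert b A) = wedge (ext_vec (u b)) (wedge_fam u A)"
    using insert by (simp add: wedge_fam_insert_min)
  show ?case
  proof (cases i b rule: linorder_cases)
    case less
    then have *: "\<And>a. a \<in> insert b A \<Longrightarrow> i < a" using insert by force
    then have "i \<notin> insert b A" "shuffle_sign {i} (insert b A) = 1"
      by (blast, intro shuffle_sign_less, blast)
    then show ?thesis
      using wedge_fam_insert_min[of "insert b A" i u, OF *] by simp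
  next
    case equal
    then show ?thesis
      by (simp add: fam wedge_assoc[symmetric] wedge_vec_self wedge_simps)
  next
    case greater
    have bA: "b \<notin> A" using insert by blast
    have "shuffle_sign {i} (insert b A) = - shuffle_sign {i} A"
      using shuffle_sign_Un_right[of "{b}" A "{i}"] shuffle_sign_single[OF greater] bA by simp
    moreover have "wedge_fam u (insert i (insert b A)) = wedge (ext_vec (u b)) (wedge_fam u (insert i A))"
      using insert greater by (subst insert_commute, subst wedge_fam_insert_min) auto
    moreover have "wedge (ext_vec (u i)) (wedge_fam u (insert b A)) =
        - wedge (ext_vec (u b)) (wedge (ext_vec (u i)) (wedge_fam u A))"
      unfolding fam wedge_assoc[symmetric]
      by (subst wedge_vec_anticommute) (simp add: wedge_simps)
    ultimately show ?thesis
      using greater by (auto simp: insert.IH wedge_simps)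
  qed
qed

lemma ext_map_wedge_vec:
  assumes "linear g"
  shows "ext_map g (wedge (ext_vec v) y) = wedge (ext_vec (g v)) (ext_map g y)"
proof -
  have basis: "ext_map g (wedge (ext_vec (axis i 1)) (axis A 1)) =
      wedge (ext_vec (g (axis i 1))) (ext_map g (axis A 1))" for i A
    using wedge_vec_fam[of "\<lambda>a. g (axis a 1)" i A]
    by (auto simp: ext_vec_axis wedge_axis ext_map_axis linear_cmul[OF linear_ext_map]
        linear_0[OF linear_ext_map])
  have 1: "ext_map g (wedge (ext_vec (axis i 1)) y) =
      wedge (ext_vec (g (axis i 1))) (ext_map g y)" for i y
    by (rule linear_ext_eqI[OF
          linear_compose[OF linear_wedge_right linear_ext_map, unfolded o_def]
          linear_compose[OF linear_ext_map linear_wedge_right, unfolded o_def]])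
       (rule basis)
  have l: "linear (\<lambda>v. ext_map g (wedge (ext_vec v) y))"
    "linear (\<lambda>v. wedge (ext_vec (g v)) (ext_map g y))"
    by (rule linearI; simp add: linear_add[OF linear_ext_vec] linear_cmul[OF linear_ext_vec]
        linear_add[OF assms] linear_cmul[OF assms] linear_add[OF linear_ext_map]
        linear_cmul[OF linear_ext_map] wedge_simps)+
  show ?thesis
    by (rule linear_ext_eqI[OF l]) (rule 1)
qed

lemma ext_map_wedge_list:
  assumes "linear g"
  shows "ext_map g (wedge_list vs) = wedge_list (map g vs)"
  by (induction vs)
     (simp_all add: wedge_list_def ext_map_axis wedge_fam_empty ext_map_wedge_vec[OF assms])

lemma wedge_list_zero: "0 \<in> set vs \<Longrightarrow> wedge_list vs = 0"
  by (induction vs) (auto simp: wedge_list_def linear_0[OF linear_ext_vec] wedge_simps)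

lemma dim_ext_power: "dim (ext_power r :: 'n::{finite,linorder} ext set) = CARD('n) choose r"
proof -
  let ?B = "{axis A 1 |A::'n set. card A = r} :: 'n ext set"
  have B: "?B = (\<lambda>A. axis A 1) ` {A. card A = r}" by blast
  have "?B \<subseteq> Basis" by (auto simp: Basis_vec_def)
  then have "independent ?B" using independent_Basis independent_mono by blast
  then have "dim ?B = card ?B" by (rule dim_eq_card_independent)
  also have "\<dots> = card {A::'n set. card A = r}"
    unfolding B by (rule card_image) (simp add: inj_on_def axis_eq_axis)
  also have "\<dots> = CARD('n) choose r"
    using n_subsets[of "UNIV :: 'n set" r] by simp
  finally show ?thesis by (simp add: ext_power_def)
qed


section \<open>Properties of the projections\<close>

lemma linear_basis_proj: "linear (basis_proj F J)"
  by (rule linearI; unfold basis_proj_def scaleR_sum_right sum.distrib[symmetric];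
      intro sum.cong refl; simp add: algebra_simps matrix_vector_right_distrib
        matrix_vector_mult_scaleR)

lemma basis_proj_sum:
  assumes "F \<in> GL"
  shows "basis_proj F J (\<Sum>j\<in>UNIV. \<alpha> j *\<^sub>R column j F) = (\<Sum>j\<in>J. \<alpha> j *\<^sub>R column j F)"
proof -
  have "(\<Sum>j\<in>UNIV. \<alpha> j *\<^sub>R column j F) = F *v (\<chi> j. \<alpha> j)"
    by (simp add: matrix_mult_sum scalar_mult_eq_scaleR)
  moreover have "matrix_inv F ** F = mat 1"
    using someI_ex[of "\<lambda>A'. F ** A' = mat 1 \<and> A' ** F = mat 1"] assms
    by (simp add: GL_def invertible_def matrix_inv_def)
  ultimately show ?thesis
    by (simp add: basis_proj_def matrix_vector_mul_assoc)
qed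

lemma ext_proj_wedge_column:
  assumes "F \<in> GL"
  shows "ext_proj F J (wedge_fam (\<lambda>a. column a F) A) =
     (if A \<subseteq> J then wedge_fam (\<lambda>a. column a F) A else 0)"
proof -
  have col: "basis_proj F J (column a F) = (if a \<in> J then column a F else 0)" for a
  proof -
    have "column a F = (\<Sum>j\<in>UNIV. (if j = a then 1 else 0) *\<^sub>R column j F)"
      by (simp add: if_distrib[of "\<lambda>c. c *\<^sub>R _"] cong: if_cong)
    then have "basis_proj F J (column a F) = (\<Sum>j\<in>J. (if j = a then 1 else 0) *\<^sub>R column j F)"
      using basis_proj_sum[OF assms] by metis
    then show ?thesis
      by (simp add: if_distrib[of "\<lambda>c. c *\<^sub>R _"] cong: if_cong)
  qed
  have "ext_proj F J (wedge_fam (\<lambda>a. column a F) A) =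
      wedge_list (map (\<lambda>a. if a \<in> J then column a F else 0) (sorted_list_of_set A))"
    by (simp add: ext_proj_def wedge_fam_def ext_map_wedge_list[OF linear_basis_proj] col o_def)
  also have "\<dots> = (if A \<subseteq> J then wedge_fam (\<lambda>a. column a F) A else 0)"
  proof (cases "A \<subseteq> J")
    case True
    then have "map (\<lambda>a. if a \<in> J then column a F else 0) (sorted_list_of_set A) =
        map (\<lambda>a. column a F) (sorted_list_of_set A)" by (intro map_cong) auto
    with True show ?thesis by (simp only: wedge_fam_def if_True)
  next
    case False
    then show ?thesis by (auto intro!: wedge_list_zero)
  qed
  finally show ?thesis .
qed

end

theory Submission
  imports Defs
begin

text \<open>
  Projecting along the columns of a permutation matrix, listed so that the first \<open>k = n - d\<close>
  of them are the vectors \<open>e\<^sub>j\<close> with \<open>j \<in> J\<close>, keeps the coordinates of \<open>e\<^sub>A\<close> with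
  \<open>A \<subseteq> J\<close> and kills the others. Let \<open>S\<close> be a set of \<open>dim W\<close> coordinates that can be
  prescribed freely on \<open>W\<close> (\<open>subspace_dual_coordinates\<close>). The image of \<open>W\<close> then has dimension
  at least the number of \<open>A \<in> S\<close> with \<open>A \<subseteq> J\<close>. A fixed \<open>r\<close>-set lies in a uniformly random
  \<open>k\<close>-set \<open>J\<close> with probability \<open>(k choose r) / (n choose r)\<close>, so this number is on average
  \<open>dim W * (k choose r) / (n choose r)\<close>, and some \<open>J\<close> does at least as well as the average
  (\<open>exists_dense_subset\<close>). So the inequality holds at one permutation matrix.

  It remains to spread it to a Zariski open set, which works because a rank can only drop where
  certain minors vanish. The projection involves the inverse of the matrix, so these minors are
  rational functions of its entries, but their only denominators are powers of the determinant,
  and the nonvanishing locus of such a function in the general linear group is Zariski open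
  (\<open>zariski_open_regular_nonzero\<close>). The minor chosen here equals \<open>1\<close> at the permutation matrix,
  and wherever it does not vanish the dimension bound persists
  (\<open>card_le_dim_if_minor_nonzero\<close>).
\<close>


section \<open>Coordinates on a subspace\<close>

text \<open>
  This is Gaussian elimination: \<open>w\<close> is a reduced basis of \<open>W\<close> with pivots \<open>S\<close>. A largest \<open>S\<close>
  will do, since a vector of \<open>W\<close> outside the span of \<open>w ` S\<close> would provide a further pivot.
\<close>
lemma subspace_dual_coordinates:
  fixes W :: "(real ^ 'i::finite) set"
  assumes W: "subspace W"
  shows "\<exists>S w. dim W \<le> card S \<and> (\<forall>A\<in>S. w A \<in> W \<and> (\<forall>B\<in>S. w A $ B = (if A = B then 1 else 0)))"
proof -
  define dual where
    "dual S w \<longleftrightarrow> (\<forall>A\<in>S. w A \<in> W \<and> (\<forall>B\<in>S. w A $ B = (if A = B then 1 else 0)))" for S w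
  define P where "P S \<longleftrightarrow> (\<exists>w. dual S w)" for S
  have "P {}" by (simp add: P_def dual_def)
  moreover have "\<forall>S. P S \<longrightarrow> card S < Suc CARD('i)"
    by (simp add: less_Suc_eq_le card_mono)
  ultimately have "\<exists>S. P S \<and> (\<forall>T. P T \<longrightarrow> card T \<le> card S)"
    by (rule ex_has_greatest_nat)
  then obtain S w where "dual S w" and max: "\<And>T w. dual T w \<Longrightarrow> card T \<le> card S"
    unfolding P_def by blast
  then have wW: "w A \<in> W" and delta: "B \<in> S \<Longrightarrow> w A $ B = (if A = B then 1 else 0)"
    if "A \<in> S" for A B
    using that by (auto simp: dual_def)
  have "x \<in> span (w ` S)" if x: "x \<in> W" for x
  proof -
    define y where "y = x - (\<Sum>A\<in>S. x $ A *\<^sub>R w A)"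
    have yW: "y \<in> W"
      unfolding y_def by (intro subspace_diff subspace_sum subspace_scale W x wW)
    have yS: "y $ B = 0" if "B \<in> S" for B
    proof -
      have "(\<Sum>A\<in>S. x $ A * w A $ B) = (\<Sum>A\<in>S. if A = B then x $ B else 0)"
        using delta that by (intro sum.cong) auto
      then show ?thesis using that by (simp add: y_def)
    qed
    have "y = 0"
    proof (rule ccontr)
      assume "y \<noteq> 0"
      then obtain i where i: "y $ i \<noteq> 0" by (auto simp: vec_eq_iff)
      then have iS: "i \<notin> S" using yS by blast
      \<comment> \<open>Make \<open>i\<close> a new pivot, with row \<open>z\<close>, and clear column \<open>i\<close> from the old rows.\<close>
      define z where "z = (1 / y $ i) *\<^sub>R y"
      have z: "z \<in> W" "z $ i = 1" "\<And>B. B \<in> S \<Longrightarrow> z $ B = 0"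
        using yW i yS by (auto simp: z_def intro: subspace_scale W)
      define w' where "w' A = (if A = i then z else w A - w A $ i *\<^sub>R z)" for A
      have "dual (insert i S) w'"
        unfolding dual_def using wW delta z iS
        by (auto simp: w'_def intro!: subspace_diff subspace_scale W)
      from max[OF this] iS show False by simp
    qed
    then have "x = (\<Sum>A\<in>S. x $ A *\<^sub>R w A)" by (simp add: y_def)
    also have "\<dots> \<in> span (w ` S)" by (intro span_sum span_scale span_base) auto
    finally show ?thesis .
  qed
  then have "dim W \<le> card (w ` S)" by (intro span_card_ge_dim) (auto intro: wW)
  also have "\<dots> \<le> card S" by (simp add: card_image_le)
  finally show ?thesis using \<open>dual S w\<close> unfolding dual_def by blast
qed

lemma ext_power_coord:
  assumes "x \<in> ext_power r" "card A \<noteq> r"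
  shows "x $ A = 0"
proof -
  have "x \<in> {x. x $ A = 0}"
    using assms(1) unfolding ext_power_def
    by (rule span_subspace_induct) (use assms(2) in \<open>auto simp: subspace_def axis_def\<close>)
  then show ?thesis by simp
qed


section \<open>Averaging over the sets of a given size\<close>

lemma card_supersets:
  fixes A :: "'a::finite set"
  assumes "card A \<le> k"
  shows "card {J. card J = k \<and> A \<subseteq> J} = (CARD('a) - card A) choose (k - card A)"
proof -
  have "bij_betw (\<lambda>J. J - A) {J. card J = k \<and> A \<subseteq> J} {B. B \<subseteq> - A \<and> card B = k - card A}"
  proof (rule bij_betw_byWitness[where f' = "\<lambda>B. B \<union> A"])
    show "(\<lambda>B. B \<union> A) ` {B. B \<subseteq> - A \<and> card B = k - card A} \<subseteq> {J. card J = k \<and> A \<subseteq> J}"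
    proof clarsimp
      fix B assume "B \<subseteq> - A" "card B = k - card A"
      then show "card (B \<union> A) = k"
        using assms by (subst card_Un_disjoint) auto
    qed
  qed (auto simp: card_Diff_subset)
  then have "card {J. card J = k \<and> A \<subseteq> J} = card {B. B \<subseteq> - A \<and> card B = k - card A}"
    by (rule bij_betw_same_card)
  also have "\<dots> = card (- A) choose (k - card A)" by (rule n_subsets) simp
  finally show ?thesis by (simp add: Compl_eq_Diff_UNIV card_Diff_subset)
qed

text \<open>
  Double counting of the pairs \<open>A \<subseteq> J\<close>: the average over \<open>J\<close> of the number of members of \<open>S\<close>
  inside \<open>J\<close> is \<open>card S\<close> times \<open>(n - r choose k - r) / (n choose k)\<close>, and this ratio equals
  \<open>(k choose r) / (n choose r)\<close>. The inequality is cleared of denominators.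
\<close>
lemma exists_dense_subset:
  fixes S :: "'a::finite set set"
  assumes card_S: "\<And>A. A \<in> S \<Longrightarrow> card A = r" and r: "r \<le> k" and k: "k \<le> CARD('a)"
  shows "\<exists>J. card J = k \<and>
    card S * (k choose r) \<le> card {A \<in> S. A \<subseteq> J} * (CARD('a) choose r)"
proof (rule ccontr)
  let ?n = "CARD('a)" and ?\<J> = "{J :: 'a set. card J = k}"
  assume "\<not> ?thesis"
  then have less: "card {A \<in> S. A \<subseteq> J} * (?n choose r) < card S * (k choose r)" if "J \<in> ?\<J>" for J
    using that by (auto simp: not_le)
  have card_\<J>: "card ?\<J> = ?n choose k"
    using n_subsets[of "UNIV :: 'a set" k] by simp
  have "?\<J> \<noteq> {}"
    using card_\<J> k by (metis binomial_eq_0_iff card.empty not_le)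
  have "(\<Sum>J\<in>?\<J>. card {A \<in> S. A \<subseteq> J}) = (\<Sum>A\<in>S. card {J \<in> ?\<J>. A \<subseteq> J})"
    by (rule sum_multicount_gen) auto
  also have "\<dots> = (\<Sum>A\<in>S. (?n - r) choose (k - r))"
    by (intro sum.cong refl) (use card_supersets card_S r in force)
  finally have count: "(\<Sum>J\<in>?\<J>. card {A \<in> S. A \<subseteq> J}) = card S * ((?n - r) choose (k - r))"
    by simp
  have "(\<Sum>J\<in>?\<J>. card {A \<in> S. A \<subseteq> J} * (?n choose r)) < (\<Sum>J\<in>?\<J>. card S * (k choose r))"
    by (rule sum_strict_mono) (use less \<open>?\<J> \<noteq> {}\<close> in auto)
  then have "card S * ((?n - r) choose (k - r)) * (?n choose r) < (?n choose k) * (card S * (k choose r))"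
    by (simp add: sum_distrib_right[symmetric] count card_\<J>)
  moreover have "(?n choose k) * (k choose r) = (?n choose r) * ((?n - r) choose (k - r))"
    by (rule choose_mult[OF r k])
  ultimately show False by (metis less_irrefl mult.commute mult.left_commute)
qed


section \<open>Permutation matrices\<close>

text \<open>
  The rank \<open>i \<mapsto> card {..i}\<close> is an injection of \<open>[n]\<close> into \<open>{1..n}\<close>, hence onto, and \<open>first k\<close> is
  the preimage of \<open>{1..k}\<close>.
\<close>
lemma card_first:
  assumes "k \<le> CARD('n::{finite,linorder})"
  shows "card (first k :: 'n set) = k"
proof -
  let ?rank = "\<lambda>i::'n. card {..i}"
  have mono: "?rank i < ?rank j" if "i < j" for i j
    by (rule psubset_card_mono) (use that in \<open>auto simp: less_le_not_le\<close>)
  have inj: "inj ?rank"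
    by (rule injI) (metis mono linorder_neqE less_irrefl)
  have "?rank i \<in> {1..CARD('n)}" for i
    by (auto simp: Suc_le_eq card_gt_0_iff intro: card_mono)
  then have "range ?rank = {1..CARD('n)}"
    by (intro card_subset_eq) (auto simp: card_image[OF inj])
  moreover have "?rank ` first k = range ?rank \<inter> {..k}"
    by (auto simp: first_def)
  ultimately have "?rank ` first k = {1..k}" using assms by auto
  then show ?thesis
    using card_image[OF inj_on_subset[OF inj subset_UNIV], of "first k"] by simp
qed

lemma exists_perm_image_eq:
  fixes I J :: "'a::finite set"
  assumes "card I = card J"
  shows "\<exists>\<sigma>. bij \<sigma> \<and> \<sigma> ` I = J"
proof -
  obtain f where f: "bij_betw f I J"
    using finite_same_card_bij[of I J] assms by auto
  have "card (- I) = card (- J)" using assms by (simp add: Compl_eq_Diff_UNIV card_Diff_subset)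
  then obtain g where g: "bij_betw g (- I) (- J)"
    using finite_same_card_bij[of "- I" "- J"] by auto
  let ?h = "\<lambda>x. if x \<in> I then f x else g x"
  have "bij_betw ?h (I \<union> - I) (J \<union> - J)"
    by (rule bij_betw_disjoint_Un) (use f g in auto)
  moreover have "?h ` I = J" using f by (simp add: bij_betw_def)
  ultimately show ?thesis by (metis Compl_partition)
qed

definition perm_mat :: "('n \<Rightarrow> 'n) \<Rightarrow> real ^ 'n ^ 'n" where
  "perm_mat \<sigma> = (\<chi> i j. if i = \<sigma> j then 1 else 0)"

lemma column_perm_mat: "column j (perm_mat \<sigma>) = axis (\<sigma> j) 1"
  by (auto simp: column_def perm_mat_def axis_def vec_eq_iff)

lemma perm_mat_expansion:
  assumes "bij \<sigma>"
  shows "v = (\<Sum>j\<in>UNIV. v $ \<sigma> j *\<^sub>R column j (perm_mat \<sigma>))"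
proof -
  have "(\<Sum>j\<in>UNIV. v $ \<sigma> j *\<^sub>R column j (perm_mat \<sigma>)) = (\<Sum>i\<in>UNIV. v $ i *\<^sub>R axis i 1)"
    unfolding column_perm_mat
    by (rule sum.reindex_bij_betw[OF assms, of "\<lambda>i. v $ i *\<^sub>R axis i 1"])
  then show ?thesis
    using basis_expansion[of v] by (simp add: scalar_mult_eq_scaleR)
qed

lemma perm_mat_GL:
  assumes "bij \<sigma>"
  shows "perm_mat \<sigma> \<in> GL"
proof -
  have "perm_mat \<sigma> *v (\<chi> j. v $ \<sigma> j) = v" for v
    using perm_mat_expansion[OF assms, of v] by (simp add: matrix_mult_sum scalar_mult_eq_scaleR)
  then have "surj ((*v) (perm_mat \<sigma>))" by (rule surjI)
  then show ?thesis
    by (simp add: GL_def invertible_right_inverse matrix_right_invertible_surjective)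
qed

lemma ext_proj_perm_mat_axis:
  fixes \<sigma> :: "'n::{finite,linorder} \<Rightarrow> 'n"
  assumes "bij \<sigma>"
  shows "ext_proj (perm_mat \<sigma>) I (axis A 1) = (if A \<subseteq> \<sigma> ` I then axis A 1 else 0)"
proof -
  have proj: "basis_proj (perm_mat \<sigma>) I (axis a 1) = (if a \<in> \<sigma> ` I then axis a 1 else 0)" for a
  proof -
    have "basis_proj (perm_mat \<sigma>) I (axis a 1) = (\<Sum>j\<in>I. axis a (1 :: real) $ \<sigma> j *\<^sub>R axis (\<sigma> j) 1)"
      using basis_proj_sum[OF perm_mat_GL[OF assms], of I "\<lambda>j. axis a 1 $ \<sigma> j"]
      unfolding perm_mat_expansion[OF assms, symmetric] unfolding column_perm_mat .
    also have "\<dots> = (\<Sum>i\<in>\<sigma> ` I. axis a (1 :: real) $ i *\<^sub>R axis i 1)"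
      by (subst sum.reindex) (use assms in \<open>auto simp: bij_def inj_on_def\<close>)
    also have "\<dots> = (\<Sum>i\<in>\<sigma> ` I. if i = a then axis a 1 else 0)"
      by (intro sum.cong refl) (auto simp: axis_def)
    finally show ?thesis by simp
  qed
  show ?thesis
  proof (cases "A \<subseteq> \<sigma> ` I")
    case True
    then have "map (\<lambda>a. basis_proj (perm_mat \<sigma>) I (axis a 1)) (sorted_list_of_set A) =
        map (\<lambda>a. axis a 1) (sorted_list_of_set A)"
      by (intro map_cong) (auto simp: proj)
    with True show ?thesis
      using wedge_fam_axis[of A] by (simp only: ext_proj_def ext_map_axis wedge_fam_def if_True)
  next
    case False
    then have "wedge_fam (\<lambda>a. basis_proj (perm_mat \<sigma>) I (axis a 1)) A = 0"
      unfolding wedge_fam_def by (intro wedge_list_zero) (auto simp: proj)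
    with False show ?thesis by (simp add: ext_proj_def ext_map_axis)
  qed
qed

lemma linear_ext_proj: "linear (ext_proj F J)"
  by (simp add: ext_proj_def linear_ext_map)

lemma ext_proj_perm_mat_coord:
  fixes \<sigma> :: "'n::{finite,linorder} \<Rightarrow> 'n"
  assumes "bij \<sigma>"
  shows "ext_proj (perm_mat \<sigma>) I x $ A = (if A \<subseteq> \<sigma> ` I then x $ A else 0)"
proof -
  have "linear (\<lambda>x :: 'n ext. \<chi> A. if A \<subseteq> \<sigma> ` I then x $ A else 0)"
    by (rule linearI) (auto simp: vec_eq_iff)
  then have "ext_proj (perm_mat \<sigma>) I x = (\<chi> A. if A \<subseteq> \<sigma> ` I then x $ A else 0)"
  proof (rule linear_ext_eqI[OF linear_ext_proj])
    show "ext_proj (perm_mat \<sigma>) I (axis B 1) = (\<chi> A. if A \<subseteq> \<sigma> ` I then axis B 1 $ A else 0)" for B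
      unfolding ext_proj_perm_mat_axis[OF assms] by (auto simp: vec_eq_iff axis_def)
  qed
  then show ?thesis by simp
qed


section \<open>Regular functions on the general linear group\<close>

text \<open>
  The elements of the localization of the polynomial ring at the determinant, that is, the regular
  functions on \<open>GL\<close> as an affine variety.
\<close>
definition regular_on_GL :: "(real ^ 'n ^ 'n \<Rightarrow> real) \<Rightarrow> bool" where
  "regular_on_GL f \<longleftrightarrow>
     (\<exists>N p. real_polynomial_function p \<and> (\<forall>F\<in>GL. f F * det F ^ N = p F))"

lemma real_polynomial_function_entry:
  "real_polynomial_function (\<lambda>F :: real ^ 'n ^ 'm. F $ i $ j)"
proof -
  have "bounded_linear (\<lambda>F :: real ^ 'n ^ 'm. F $ i $ j)"
    by (rule bounded_linear_compose[OF bounded_linear_vec_nth bounded_linear_vec_nth])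
  then show ?thesis by (rule real_polynomial_function.intros(1))
qed

lemma real_polynomial_function_det:
  fixes M :: "'a::euclidean_space \<Rightarrow> real ^ 'm ^ 'm"
  assumes "\<And>i j. real_polynomial_function (\<lambda>x. M x $ i $ j)"
  shows "real_polynomial_function (\<lambda>x. det (M x))"
  unfolding det_def using assms
  by (intro real_polynomial_function_sum real_polynomial_function.intros(4)
      real_polynomial_function.intros(2) real_polynomial_function_prod) (auto simp: finite_permutations)

lemma regular_if_polynomial:
  assumes "real_polynomial_function f"
  shows "regular_on_GL f"
proof -
  have "\<forall>F\<in>GL. f F * det F ^ 0 = f F" by simp
  with assms show ?thesis unfolding regular_on_GL_def by blast
qed

lemma regular_const: "regular_on_GL (\<lambda>F. c)"
  by (simp add: regular_if_polynomial real_polynomial_function.intros(2))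

lemma regular_entry: "regular_on_GL (\<lambda>F. F $ i $ j)"
  by (simp add: regular_if_polynomial real_polynomial_function_entry)

lemma det_is_real_polynomial_function: "real_polynomial_function (\<lambda>F :: real ^ 'n ^ 'n. det F)"
  by (intro real_polynomial_function_det real_polynomial_function_entry)

lemma regular_mult:
  assumes "regular_on_GL f" "regular_on_GL g"
  shows "regular_on_GL (\<lambda>F. f F * g F)"
proof -
  obtain N p M q where p: "real_polynomial_function p" "\<forall>F\<in>GL. f F * det F ^ N = p F"
    and q: "real_polynomial_function q" "\<forall>F\<in>GL. g F * det F ^ M = q F"
    using assms unfolding regular_on_GL_def by blast
  have "f F * g F * det F ^ (N + M) = p F * q F" if "F \<in> GL" for F
  proof -
    have "f F * g F * det F ^ (N + M) = (f F * det F ^ N) * (g F * det F ^ M)"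
      by (simp add: power_add mult_ac)
    then show ?thesis using p(2) q(2) that by simp
  qed
  then show ?thesis
    unfolding regular_on_GL_def using real_polynomial_function.intros(4)[OF p(1) q(1)] by blast
qed

lemma regular_add:
  assumes "regular_on_GL f" "regular_on_GL g"
  shows "regular_on_GL (\<lambda>F. f F + g F)"
proof -
  obtain N p M q where p: "real_polynomial_function p" "\<forall>F\<in>GL. f F * det F ^ N = p F"
    and q: "real_polynomial_function q" "\<forall>F\<in>GL. g F * det F ^ M = q F"
    using assms unfolding regular_on_GL_def by blast
  have "(f F + g F) * det F ^ (N + M) = p F * det F ^ M + q F * det F ^ N" if "F \<in> GL" for F
  proof -
    have "(f F + g F) * det F ^ (N + M) =
        (f F * det F ^ N) * det F ^ M + (g F * det F ^ M) * det F ^ N"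
      by (simp add: power_add algebra_simps)
    then show ?thesis using p(2) q(2) that by simp
  qed
  moreover have "real_polynomial_function (\<lambda>F. p F * det F ^ M + q F * det F ^ N)"
    by (intro real_polynomial_function.intros(3) real_polynomial_function.intros(4) p(1) q(1)
        real_polynomial_function_power det_is_real_polynomial_function)
  ultimately show ?thesis unfolding regular_on_GL_def by blast
qed

lemma regular_sum:
  assumes "\<And>i. i \<in> I \<Longrightarrow> regular_on_GL (f i)"
  shows "regular_on_GL (\<lambda>F. \<Sum>i\<in>I. f i F)"
  using assms by (induction I rule: infinite_finite_induct) (auto intro: regular_add regular_const)

lemma regular_prod:
  assumes "\<And>i. i \<in> I \<Longrightarrow> regular_on_GL (f i)"
  shows "regular_on_GL (\<lambda>F. \<Prod>i\<in>I. f i F)"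
  using assms by (induction I rule: infinite_finite_induct) (auto intro: regular_mult regular_const)

lemma regular_det:
  fixes M :: "real ^ 'n ^ 'n \<Rightarrow> real ^ 'm ^ 'm"
  assumes "\<And>i j. regular_on_GL (\<lambda>F. M F $ i $ j)"
  shows "regular_on_GL (\<lambda>F. det (M F))"
  unfolding det_def by (intro regular_sum regular_mult regular_const regular_prod assms)

text \<open>By Cramer's rule, one factor of the determinant clears the denominator.\<close>
lemma regular_inverse_coord: "regular_on_GL (\<lambda>F. (matrix_inv F *v v) $ k)"
proof -
  let ?M = "\<lambda>F. \<chi> i j. if j = k then v $ i else F $ i $ j"
  have "(matrix_inv F *v v) $ k * det F ^ 1 = det (?M F)" if "F \<in> GL" for F
  proof -
    have det: "det F \<noteq> 0" using that by (simp add: GL_def invertible_det_nz)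
    have "F ** matrix_inv F = mat 1"
      using someI_ex[of "\<lambda>A'. F ** A' = mat 1 \<and> A' ** F = mat 1"] that
      by (simp add: GL_def invertible_def matrix_inv_def)
    then have "F *v (matrix_inv F *v v) = v" by (simp add: matrix_vector_mul_assoc)
    then have "matrix_inv F *v v = (\<chi> k. det (\<chi> i j. if j = k then v $ i else F $ i $ j) / det F)"
      by (simp only: cramer[OF det])
    then show ?thesis using det by simp
  qed
  moreover have "real_polynomial_function (\<lambda>F. if j = k then v $ i else F $ i $ j)" for i j
    by (cases "j = k") (auto intro: real_polynomial_function.intros(2) real_polynomial_function_entry)
  then have "real_polynomial_function (\<lambda>F. det (?M F))"
    by (intro real_polynomial_function_det) simp
  ultimately show ?thesis unfolding regular_on_GL_def by blast
qed

text \<open>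
  From here on, regularity passes through the construction of the induced map: the coordinates of a
  wedge are bilinear in those of its factors, with coefficients that do not depend on \<open>F\<close>.
\<close>
lemma regular_wedge:
  assumes "\<And>A. regular_on_GL (\<lambda>F. x F $ A)" "\<And>A. regular_on_GL (\<lambda>F. y F $ A)"
  shows "regular_on_GL (\<lambda>F. wedge (x F) (y F) $ C)"
proof -
  have "wedge (x F) (y F) $ C = (\<Sum>A\<in>UNIV. \<Sum>B\<in>UNIV.
      x F $ A * y F $ B * (if A \<inter> B = {} then shuffle_sign A B * axis (A \<union> B) 1 $ C else 0))" for F
    unfolding wedge_def sum_component by (intro sum.cong refl) auto
  then show ?thesis
    by (simp only:) (intro regular_sum regular_mult regular_const assms)
qed

lemma regular_wedge_list:
  fixes u :: "real ^ 'n ^ 'n \<Rightarrow> 'a \<Rightarrow> real ^ 'm::{finite,linorder}"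
  assumes "\<And>a i. regular_on_GL (\<lambda>F. u F a $ i)"
  shows "regular_on_GL (\<lambda>F. wedge_list (map (u F) as) $ C)"
proof (induction as arbitrary: C)
  case Nil
  then show ?case by (simp add: wedge_list_def regular_const)
next
  case (Cons a as)
  have "regular_on_GL (\<lambda>F. ext_vec (u F a) $ A)" for A
    unfolding ext_vec_def sum_component vector_scaleR_component real_scaleR_def
    by (intro regular_sum regular_mult regular_const assms)
  from regular_wedge[OF this Cons.IH] show ?case by (simp add: wedge_list_def)
qed

lemma regular_ext_proj: "regular_on_GL (\<lambda>F. ext_proj F J w $ C)"
proof -
  have "regular_on_GL (\<lambda>F. basis_proj F J (axis a 1) $ i)" for a i
    unfolding basis_proj_def column_def sum_component vector_scaleR_component real_scaleR_def
    by (simp, intro regular_sum regular_mult regular_inverse_coord regular_entry)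
  then show ?thesis
    unfolding ext_proj_def ext_map_def wedge_fam_def sum_component vector_scaleR_component real_scaleR_def
    by (intro regular_sum regular_mult regular_const regular_wedge_list)
qed

text \<open>On \<open>GL\<close> the determinant is invertible, so a regular function has the zeros of its numerator.\<close>
lemma zariski_open_regular_nonzero:
  assumes "regular_on_GL f"
  shows "zariski_open_in GL {F \<in> GL. f F \<noteq> 0}"
proof -
  obtain N p where p: "real_polynomial_function p" "\<forall>F\<in>GL. f F * det F ^ N = p F"
    using assms unfolding regular_on_GL_def by blast
  have "f F \<noteq> 0 \<longleftrightarrow> p F \<noteq> 0" if "F \<in> GL" for F
    using p(2) that by (auto simp: GL_def invertible_det_nz dest: bspec[of _ _ F])
  then have "{F \<in> GL. f F \<noteq> 0} = GL - {F. \<forall>q\<in>{p}. q F = 0}" by auto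
  moreover have "zariski_closed {F. \<forall>q\<in>{p}. q F = 0}"
    unfolding zariski_closed_def using p(1) by blast
  ultimately show ?thesis unfolding zariski_open_in_def by blast
qed


section \<open>The projection inequality\<close>

text \<open>
  The square matrix \<open>(y A $ B)\<close> with \<open>A, B \<in> T\<close>, padded by an identity block to the whole index
  type. The padding does not change the determinant, which is therefore a minor of the family \<open>y\<close>,
  and it avoids determinants indexed by a set.
\<close>
definition minor_mat :: "'i set \<Rightarrow> ('i \<Rightarrow> real ^ 'i) \<Rightarrow> real ^ 'i ^ 'i" where
  "minor_mat T y =
     (\<chi> A B. if A \<in> T \<and> B \<in> T then y A $ B else if A = B then 1 else 0)"

text \<open>
  If the minor does not vanish, the rows indexed by \<open>T\<close> are distinct and independent; they are the
  images of the vectors \<open>y A \<in> X\<close> under the coordinate projection \<open>P\<close>.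
\<close>
lemma card_le_dim_if_minor_nonzero:
  fixes y :: "'i::finite \<Rightarrow> real ^ 'i"
  assumes det: "det (minor_mat T y) \<noteq> 0" and y: "\<And>A. A \<in> T \<Longrightarrow> y A \<in> X"
  shows "card T \<le> dim X"
proof -
  let ?M = "minor_mat T y"
  define P :: "real ^ 'i \<Rightarrow> real ^ 'i" where "P x = (\<chi> B. if B \<in> T then x $ B else 0)" for x
  have P: "linear P" by (rule linearI) (auto simp: P_def vec_eq_iff)
  have row: "row A ?M = P (y A)" if "A \<in> T" for A
    using that by (auto simp: row_def minor_mat_def P_def vec_eq_iff)
  have "inj (\<lambda>A. row A ?M)"
    by (rule injI) (metis det det_identical_rows)
  then have "card T = card ((\<lambda>A. row A ?M) ` T)"
    by (metis card_image inj_on_subset subset_UNIV)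
  also have "independent (rows ?M)"
    using det det_dependent_rows[of ?M] by (auto simp: dependent_vec_eq)
  then have "independent ((\<lambda>A. row A ?M) ` T)"
    by (rule independent_mono) (auto simp: rows_def)
  then have "card ((\<lambda>A. row A ?M) ` T) = dim ((\<lambda>A. row A ?M) ` T)"
    by (simp add: dim_eq_card_independent)
  also have "\<dots> \<le> dim (P ` X)"
    by (rule dim_subset) (use row y in auto)
  also have "\<dots> \<le> dim X" by (rule dim_image_le[OF P])
  finally show ?thesis .
qed

theorem corollary3p5:
  fixes W :: "'n::{finite,linorder} ext set"
    and d r :: nat
  assumes "0 < d" and "d \<le> CARD('n)"
    and "r \<le> CARD('n) - d"
    and "subspace W" and "W \<subseteq> ext_power r"
  shows "\<exists>U :: (real ^ 'n::{finite,linorder} ^ 'n::{finite,linorder}) set. zariski_open_in GL U \<and> U \<noteq> {} \<and>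
    (\<forall>F\<in>U. real (dim (ext_proj F (first (CARD('n) - d)) ` W)) / real ((CARD('n) - d) choose r)
           \<ge> real (dim W) / real (CARD('n) choose r))"
proof -
  define k where "k = CARD('n) - d"
  have rk: "r \<le> k" and kn: "k \<le> CARD('n)" using assms by (auto simp: k_def)
  obtain S w where S: "dim W \<le> card S"
    and w: "\<And>A. A \<in> S \<Longrightarrow> w A \<in> W"
    and dual: "\<And>A B. A \<in> S \<Longrightarrow> B \<in> S \<Longrightarrow> w A $ B = (if A = B then 1 else 0)"
    using subspace_dual_coordinates[OF assms(4)] by metis
  have card_S: "card A = r" if "A \<in> S" for A
    using ext_power_coord[of "w A" r A] w[OF that] dual[OF that that] assms(5) by auto
  obtain J where J: "card J = k"
    and dense: "card S * (k choose r) \<le> card {A \<in> S. A \<subseteq> J} * (CARD('n) choose r)"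
    using exists_dense_subset[OF card_S rk kn] by blast
  define T where "T = {A \<in> S. A \<subseteq> J}"
  obtain \<sigma> :: "'n \<Rightarrow> 'n" where \<sigma>: "bij \<sigma>" "\<sigma> ` first k = J"
    using exists_perm_image_eq[of "first k" J] card_first[OF kn] J by auto
  define f where "f F = det (minor_mat T (\<lambda>A. ext_proj F (first k) (w A)))" for F :: "real ^ 'n::{finite,linorder} ^ 'n::{finite,linorder}"
  define U where "U = {F \<in> GL. f F \<noteq> 0}"
  have "regular_on_GL (\<lambda>F. if A \<in> T \<and> B \<in> T then ext_proj F (first k) (w A) $ B
      else if A = B then 1 else 0)" for A B
    by (cases "A \<in> T \<and> B \<in> T") (auto simp: regular_const intro!: regular_ext_proj)
  then have "regular_on_GL f"
    unfolding f_def by (intro regular_det) (simp add: minor_mat_def)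
  then have "zariski_open_in GL U"
    unfolding U_def by (rule zariski_open_regular_nonzero)
  moreover have "perm_mat \<sigma> \<in> U"
  proof -
    \<comment> \<open>All members of \<open>T\<close> lie in \<open>J\<close>, so the projection keeps their coordinates, and on these the
      vectors \<open>w A\<close> are dual.\<close>
    have "minor_mat T (\<lambda>A. ext_proj (perm_mat \<sigma>) (first k) (w A)) = mat 1"
      by (auto simp: minor_mat_def mat_def vec_eq_iff ext_proj_perm_mat_coord[OF \<sigma>(1)] \<sigma>(2) T_def dual)
    then show ?thesis by (simp add: U_def f_def perm_mat_GL[OF \<sigma>(1)])
  qed
  moreover have "real (dim W) / real (CARD('n) choose r)
      \<le> real (dim (ext_proj F (first k) ` W)) / real (k choose r)" if "F \<in> U" for F
  proof -
    have "card T \<le> dim (ext_proj F (first k) ` W)"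
      by (rule card_le_dim_if_minor_nonzero[where y = "\<lambda>A. ext_proj F (first k) (w A)"])
         (use that w in \<open>auto simp: U_def f_def T_def\<close>)
    then have "dim W * (k choose r) \<le> dim (ext_proj F (first k) ` W) * (CARD('n) choose r)"
      using S dense unfolding T_def[symmetric] by (meson le_trans mult_le_mono1)
    then have "real (dim W) * real (k choose r) \<le>
        real (dim (ext_proj F (first k) ` W)) * real (CARD('n) choose r)"
      by (metis of_nat_le_iff of_nat_mult)
    moreover have "0 < k choose r" "0 < CARD('n) choose r" using rk kn by auto
    ultimately show ?thesis by (simp add: frac_le_eq divide_simps)
  qed
  ultimately show ?thesis unfolding k_def by blast
qed

end
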